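(* Let $p\ge1$ and consider the hypergeometric weights, the recurrence matrix $T=\Lambda+\alpha^{(0)}+\Lambda^\top\alpha^{(1)}+\dots+(\Lambda^\top)^p\alpha^{(p)}$ and the operator $\vartheta$ described in the context. Then, for $n\in\{0,\dots,p-1\}$, the following Toda type system holds: $$\vartheta\alpha^{(0)}=\alpha^{(1)}-\mathfrak a_+\alpha^{(1)},$$ $$\vartheta\alpha^{(n)}=\alpha^{(n+1)}-\mathfrak a_+\alpha^{(n+1)}+\alpha^{(n)}\big(\mathfrak a_-^n\alpha^{(0)}-\alpha^{(0)}\big),$$ $$\vartheta\alpha^{(p)}=\alpha^{(p)}\big(\mathfrak a_-^p\alpha^{(0)}-\alpha^{(0)}\big).$$
   Context: All semi-infinite matrices are indexed from $0$. $\Lambda$ is the shift matrix with $\Lambda_{n,n+1}=1$ and all other entries zero. For diagonal matrices, $\mathfrak a_-\operatorname{diag}(m_0,m_1,\dots)=\operatorname{diag}(m_1,m_2,\dots)$ and $\mathfrak a_+\operatorname{diag}(m_0,m_1,\dots)=\operatorname{diag}(0,m_0,m_1,\dots)$. Weights: $w^{(a)}(k)=\frac{(b_1^{(a)})_k\cdots(b_{M^{(a)}}^{(a)})_k}{(c_1)_k\cdots(c_N)_k}\frac{(\eta^{(a)})^k}{k!}$, $k\in\mathbb N_0$, $a\in\{1,\dots,p\}$, where $\eta^{(1)},\dots,\eta^{(p)}$ are independent variables; parameters are such that the weights are well defined and all moments $\rho^{(a)}_m=\sum_{k\ge0}k^mw^{(a)}(k)$ converge absolutely. Moment matrix: $\mathscr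 M_{n,pl+a-1}=\rho^{(a)}_{n+l}$ for $n,l\in\mathbb N_0$, $a\in\{1,\dots,p\}$. Operators: $\vartheta^{(a)}=\eta^{(a)}\frac{\partial}{\partial\eta^{(a)}}$, $\vartheta=\sum_{a=1}^p\vartheta^{(a)}$, acting entrywise. It is assumed that all leading principal minors of $\mathscr M$ are nonzero, so that there is a unique Gauss--Borel factorization $\mathscr M=S^{-1}H\tilde S^{-\top}$ with $S,\tilde S$ lower unitriangular and $H$ diagonal. The recurrence matrix is $T=S\Lambda S^{-1}=H\tilde S^{-\top}(\Lambda^\top)^p\tilde S^\top H^{-1}$, which is banded with the displayed form, the $\alpha^{(m)}$ being diagonal matrices. *)

theory Defs
  imports
    "HOL-Analysis.Analysis"
    "HOL-Library.Function_Algebras"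
    "HOL-Library.Nonpos_Ints"
    "Jordan_Normal_Form.Determinant"
begin

text \<open>
  Semi-infinite matrices are functions of two indices starting from 0.
  Sums, differences and the zero matrix are the pointwise ones of
  \<^theory>\<open>HOL-Library.Function_Algebras\<close>; the matrix product is \<open>mmul\<close> below,
  never the pointwise product.
\<close>

type_synonym 'a smat = "nat \<Rightarrow> nat \<Rightarrow> 'a"

text \<open>
  In every product that is used below, the left factor has finitely many nonzero entries in each
  row or the right factor has finitely many nonzero entries in each column, so the series is a
  finite sum.
\<close>

definition mmul :: "'a::real_normed_field smat \<Rightarrow> 'a smat \<Rightarrow> 'a smat"  (infixl \<open>\<odot>\<close> 70) where
  "A \<odot> B = (\<lambda>i j. \<Sum>k. A i k * B k j)"

definition mone :: "'a::real_normed_field smat" where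
  "mone = (\<lambda>i j. if i = j then 1 else 0)"

definition mtransp :: "'a smat \<Rightarrow> 'a smat" where
  "mtransp A = (\<lambda>i j. A j i)"

fun mpow :: "'a::real_normed_field smat \<Rightarrow> nat \<Rightarrow> 'a smat" where
  "mpow A 0 = mone"
| "mpow A (Suc n) = A \<odot> mpow A n"

definition mdiag :: "(nat \<Rightarrow> 'a) \<Rightarrow> 'a::real_normed_field smat" where
  "mdiag d = (\<lambda>i j. if i = j then d i else 0)"

definition is_mdiag :: "'a::real_normed_field smat \<Rightarrow> bool" where
  "is_mdiag A \<longleftrightarrow> (\<forall>i j. i \<noteq> j \<longrightarrow> A i j = 0)"

definition lower_unitri :: "'a::real_normed_field smat \<Rightarrow> bool" where
  "lower_unitri A \<longleftrightarrow> (\<forall>i. A i i = 1) \<and> (\<forall>i j. i < j \<longrightarrow> A i j = 0)"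

text \<open>
  The inverse of a lower unitriangular matrix. An inverse of a semi-infinite matrix need not be
  unique in general, whereas the lower unitriangular one of a lower unitriangular matrix exists
  and is unique.
\<close>

definition minv :: "'a::real_normed_field smat \<Rightarrow> 'a smat" where
  "minv A = (THE B. lower_unitri B \<and> A \<odot> B = mone \<and> B \<odot> A = mone)"

definition Shift :: "'a::real_normed_field smat" where
  "Shift = (\<lambda>i j. if j = Suc i then 1 else 0)"

text \<open>The operators \<open>\<aa>\<^sub>-\<close> and \<open>\<aa>\<^sub>+\<close> on diagonal matrices.\<close>

definition shift_minus :: "'a::real_normed_field smat \<Rightarrow> 'a smat" where
  "shift_minus D = mdiag (\<lambda>n. D (Suc n) (Suc n))"

definition shift_plus :: "'a::real_normed_field smat \<Rightarrow> 'a smat" where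
  "shift_plus D = mdiag (\<lambda>n. case n of 0 \<Rightarrow> 0 | Suc m \<Rightarrow> D m m)"


text \<open>
  The weights. The index \<open>a\<close> ranges over \<open>{1..p}\<close>, \<open>b a i\<close> (\<open>1 \<le> i \<le> Mb a\<close>) is \<open>b\<^sub>i\<^sup>(\<^sup>a\<^sup>)\<close> with
  \<open>Mb a\<close> the number of these parameters, and \<open>c j\<close> (\<open>1 \<le> j \<le> N\<close>) is \<open>c\<^sub>j\<close>. The variables
  \<open>\<eta>\<^sup>(\<^sup>1\<^sup>)\<close>, ..., \<open>\<eta>\<^sup>(\<^sup>p\<^sup>)\<close> are the values of a function \<open>\<eta> :: nat \<Rightarrow> 'a\<close> at \<open>1, ..., p\<close>;
  the other values of \<open>\<eta>\<close> play no role. The type class is that of \<open>real\<close> and \<open>complex\<close>.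
\<close>

definition weight ::
  "(nat \<Rightarrow> nat) \<Rightarrow> nat \<Rightarrow> (nat \<Rightarrow> nat \<Rightarrow> 'a) \<Rightarrow> (nat \<Rightarrow> 'a)
    \<Rightarrow> (nat \<Rightarrow> 'a) \<Rightarrow> nat \<Rightarrow> nat \<Rightarrow> 'a::{real_normed_field, banach}" where
  "weight Mb N b c \<eta> a k =
     (\<Prod>i=1..Mb a. pochhammer (b a i) k) / (\<Prod>j=1..N. pochhammer (c j) k) * (\<eta> a ^ k / fact k)"

definition moment ::
  "(nat \<Rightarrow> nat) \<Rightarrow> nat \<Rightarrow> (nat \<Rightarrow> nat \<Rightarrow> 'a) \<Rightarrow> (nat \<Rightarrow> 'a)
    \<Rightarrow> (nat \<Rightarrow> 'a) \<Rightarrow> nat \<Rightarrow> nat \<Rightarrow> 'a::{real_normed_field, banach}" where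
  "moment Mb N b c \<eta> a m = (\<Sum>k. of_nat k ^ m * weight Mb N b c \<eta> a k)"

text \<open>The column index is \<open>j = p * l + a - 1\<close> with \<open>l = j div p\<close> and \<open>a = j mod p + 1 \<in> {1..p}\<close>.\<close>

definition moment_matrix ::
  "nat \<Rightarrow> (nat \<Rightarrow> nat) \<Rightarrow> nat \<Rightarrow> (nat \<Rightarrow> nat \<Rightarrow> 'a) \<Rightarrow> (nat \<Rightarrow> 'a)
    \<Rightarrow> (nat \<Rightarrow> 'a) \<Rightarrow> 'a::{real_normed_field, banach} smat" where
  "moment_matrix p Mb N b c \<eta> =
     (\<lambda>n j. moment Mb N b c \<eta> (j mod p + 1) (n + j div p))"


definition leading_minor :: "'a::real_normed_field smat \<Rightarrow> nat \<Rightarrow> 'a" where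
  "leading_minor A n = Determinant.det (Matrix.mat n n (\<lambda>(i, j). A i j))"

definition gauss_borel ::
  "'a::real_normed_field smat \<Rightarrow> 'a smat \<Rightarrow> 'a smat \<Rightarrow> 'a smat \<Rightarrow> bool" where
  "gauss_borel A S H St \<longleftrightarrow>
     lower_unitri S \<and> is_mdiag H \<and> lower_unitri St \<and>
     A = minv S \<odot> H \<odot> mtransp (minv St)"

definition gauss_borel_S :: "'a::real_normed_field smat \<Rightarrow> 'a smat" where
  "gauss_borel_S A = (THE S. \<exists>H St. gauss_borel A S H St)"

definition recurrence_matrix :: "'a::real_normed_field smat \<Rightarrow> 'a smat" where
  "recurrence_matrix A = gauss_borel_S A \<odot> Shift \<odot> minv (gauss_borel_S A)"

text \<open>
  The diagonal matrix \<open>\<alpha>\<^sup>(\<^sup>m\<^sup>)\<close> multiplying \<open>(\<Lambda>\<^sup>\<top>)\<^sup>m\<close> from the right in the lower part of \<open>T\<close>: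
  for diagonal \<open>D\<close>, the entry of \<open>(\<Lambda>\<^sup>\<top>)\<^sup>m D\<close> at \<open>(n + m, n)\<close> is \<open>D\<^sub>n\<^sub>n\<close>.
\<close>

definition subdiag :: "nat \<Rightarrow> 'a::real_normed_field smat \<Rightarrow> 'a smat" where
  "subdiag m T = mdiag (\<lambda>n. T (n + m) n)"


text \<open>
  The operator \<open>\<vartheta> = \<Sum>\<^sub>a \<eta>\<^sup>(\<^sup>a\<^sup>) \<partial>/\<partial>\<eta>\<^sup>(\<^sup>a\<^sup>)\<close> on matrix-valued functions of \<open>\<eta>\<close>, entrywise. Since \<open>deriv\<close>
  has an unspecified value where the derivative does not exist, existence of the partial
  derivatives is recorded separately in \<open>partials_exist\<close>.
\<close>

definition theta ::
  "nat \<Rightarrow> ((nat \<Rightarrow> 'a) \<Rightarrow> 'a smat) \<Rightarrow> (nat \<Rightarrow> 'a) \<Rightarrow> 'a::real_normed_field smat" where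
  "theta p F \<eta> = (\<lambda>i j. \<Sum>a=1..p. \<eta> a * deriv (\<lambda>z. F (\<eta>(a := z)) i j) (\<eta> a))"

definition partials_exist ::
  "nat \<Rightarrow> ((nat \<Rightarrow> 'a) \<Rightarrow> 'a::real_normed_field smat) \<Rightarrow> (nat \<Rightarrow> 'a) \<Rightarrow> bool" where
  "partials_exist p F \<eta> \<longleftrightarrow>
     (\<forall>a\<in>{1..p}. \<forall>i j. (\<lambda>z. F (\<eta>(a := z)) i j) field_differentiable at (\<eta> a))"

end

theory Submission
  imports Defs
begin

text \<open>
  Differentiating the moment series gives \<open>\<vartheta> M = \<Lambda> M\<close>. The factor \<open>S\<close> is the only lower
  unitriangular matrix for which \<open>S M\<close> is upper triangular. With \<open>L\<close> the strictly lower part of \<open>T\<close>,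
  the matrix \<open>(\<vartheta> S + L S) M = \<vartheta> (S M) - (T - L) S M\<close> is upper triangular, while \<open>\<vartheta> S + L S\<close> is
  strictly lower triangular, so \<open>\<vartheta> S = - L S\<close>. Applying \<open>\<vartheta>\<close> to \<open>T S = S \<Lambda>\<close> yields the Lax equation
  \<open>\<vartheta> T = T L - L T = [\<Lambda> + \<alpha>\<^sup>(\<^sup>0\<^sup>), L]\<close>, whose diagonals are the Toda system.
\<close>

section \<open>Banded semi-infinite matrices\<close>

text \<open>Row-finiteness with an explicit bound: a banded left factor makes the product a finite
  sum whatever the right factor is. \<open>m = 0\<close> means lower triangular,
  \<open>m = 1\<close> lower Hessenberg, the shape of the recurrence matrix.\<close>

definition lower_band :: "nat \<Rightarrow> 'a::real_normed_field smat \<Rightarrow> bool" where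
  "lower_band m A \<longleftrightarrow> (\<forall>i j. i + m < j \<longrightarrow> A i j = 0)"

definition upper_tri :: "'a::real_normed_field smat \<Rightarrow> bool" where
  "upper_tri A \<longleftrightarrow> (\<forall>i j. j < i \<longrightarrow> A i j = 0)"

definition strict_lower :: "'a::real_normed_field smat \<Rightarrow> 'a smat" where
  "strict_lower A = (\<lambda>i j. if j < i then A i j else 0)"

lemma sum_mult_assoc:
  fixes f h :: "nat \<Rightarrow> 'a::comm_ring_1"
  shows "(\<Sum>k\<in>K. (\<Sum>l\<in>L. f l * g l k) * h k) = (\<Sum>l\<in>L. f l * (\<Sum>k\<in>K. g l k * h k))"
  by (simp add: sum_distrib_left sum_distrib_right mult.assoc) (rule sum.swap)

lemma mmul_finite:
  assumes "finite F" and "\<And>k. k \<notin> F \<Longrightarrow> A i k * B k j = 0"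
  shows "(A \<odot> B) i j = (\<Sum>k\<in>F. A i k * B k j)"
  unfolding mmul_def by (rule suminf_finite) (use assms in auto)

lemma mmul_single:
  assumes "\<And>k. k \<noteq> l \<Longrightarrow> A i k * B k j = 0"
  shows "(A \<odot> B) i j = A i l * B l j"
  by (subst mmul_finite[of "{l}"]) (use assms in auto)

lemma mmul_lower_band:
  assumes "lower_band m A" and "i + m \<le> n"
  shows "(A \<odot> B) i j = (\<Sum>k\<le>n. A i k * B k j)"
  by (rule mmul_finite) (use assms in \<open>auto simp: lower_band_def\<close>)

lemma lower_band_mono: "lower_band m A \<Longrightarrow> m \<le> n \<Longrightarrow> lower_band n A"
  unfolding lower_band_def by (meson add_left_mono le_less_trans)

lemma lower_band_mmul:
  assumes "lower_band m A" and "lower_band n B"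
  shows "lower_band (m + n) (A \<odot> B)"
  unfolding lower_band_def
proof (intro allI impI)
  fix i j assume "i + (m + n) < j"
  then have "A i k * B k j = 0" if "k \<le> i + m" for k
    using assms that by (auto simp: lower_band_def)
  then show "(A \<odot> B) i j = 0"
    by (subst mmul_lower_band[OF assms(1) order_refl]) (auto intro: sum.neutral)
qed

text \<open>Products of semi-infinite matrices need not associate. Here row \<open>i\<close> of
  \<open>A\<close> stops at \<open>i + m\<close> and the rows of \<open>B\<close> that it meets stop
  at \<open>i + (m + n)\<close>, so two finite sums are exchanged. \<open>C\<close> is arbitrary,
  which admits the moment matrix with its full columns as last factor.\<close>

lemma mmul_assoc:
  assumes A: "lower_band m A" and B: "lower_band n B"
  shows "(A \<odot> B) \<odot> C = A \<odot> (B \<odot> C)"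
proof (intro ext)
  fix i j
  have "((A \<odot> B) \<odot> C) i j = (\<Sum>k\<le>i+(m+n). (\<Sum>l\<le>i+m. A i l * B l k) * C k j)"
    by (subst mmul_lower_band[OF lower_band_mmul[OF A B] order_refl])
       (simp add: mmul_lower_band[OF A order_refl])
  also have "\<dots> = (\<Sum>l\<le>i+m. A i l * (\<Sum>k\<le>i+(m+n). B l k * C k j))"
    by (rule sum_mult_assoc)
  also have "\<dots> = (A \<odot> (B \<odot> C)) i j"
    by (subst mmul_lower_band[OF A order_refl], rule sum.cong)
       (simp_all add: mmul_lower_band[OF B, where n="i+(m+n)"])
  finally show "((A \<odot> B) \<odot> C) i j = (A \<odot> (B \<odot> C)) i j" .
qed

lemma mmul_add_left:
  assumes "lower_band m A" and "lower_band n B"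
  shows "(A + B) \<odot> C = A \<odot> C + B \<odot> C"
proof -
  have "lower_band (max m n) A" "lower_band (max m n) B"
    using assms by (auto intro: lower_band_mono)
  moreover from this have "lower_band (max m n) (A + B)"
    by (auto simp: lower_band_def)
  ultimately show ?thesis
    by (intro ext) (simp add: mmul_lower_band[OF _ order_refl] distrib_right sum.distrib)
qed

lemma mmul_diff_left:
  assumes "lower_band m A" and "lower_band n B"
  shows "(A - B) \<odot> C = A \<odot> C - B \<odot> C"
proof -
  have "lower_band (max m n) A" "lower_band (max m n) B"
    using assms by (auto intro: lower_band_mono)
  moreover from this have "lower_band (max m n) (A - B)"
    by (auto simp: lower_band_def)
  ultimately show ?thesis
    by (intro ext) (simp add: mmul_lower_band[OF _ order_refl] left_diff_distrib sum_subtractf)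
qed

lemma mmul_minus_left: "(- A) \<odot> C = - (A \<odot> C)" if "lower_band m A"
proof -
  have "lower_band m (- A)" using that by (auto simp: lower_band_def)
  then show ?thesis using that
    by (intro ext) (simp add: mmul_lower_band[OF _ order_refl] sum_negf)
qed

lemma mmul_add_right:
  assumes "lower_band m A"
  shows "A \<odot> (B + C) = A \<odot> B + A \<odot> C"
  by (intro ext) (simp add: mmul_lower_band[OF assms order_refl] distrib_left sum.distrib)

lemma mmul_minus_right:
  assumes "lower_band m A"
  shows "A \<odot> (- B) = - (A \<odot> B)"
  by (intro ext) (simp add: mmul_lower_band[OF assms order_refl] sum_negf)

lemma mmul_mone_left [simp]: "mone \<odot> A = A"
proof (intro ext)
  show "(mone \<odot> A) i j = A i j" for i j
    by (subst mmul_single[of i]) (auto simp: mone_def)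
qed

lemma mmul_mone_right [simp]: "A \<odot> mone = A"
proof (intro ext)
  show "(A \<odot> mone) i j = A i j" for i j
    by (subst mmul_single[of j]) (auto simp: mone_def)
qed

lemma mmul_mdiag_left: "(mdiag d \<odot> A) i j = d i * A i j"
  by (subst mmul_single[of i]) (auto simp: mdiag_def)

lemma mmul_mdiag_right: "(A \<odot> mdiag d) i j = A i j * d j"
  by (subst mmul_single[of j]) (auto simp: mdiag_def)

lemma mmul_Shift_left: "(Shift \<odot> A) i j = A (Suc i) j"
  by (subst mmul_single[of "Suc i"]) (auto simp: Shift_def)

lemma mmul_Shift_right: "(A \<odot> Shift) i j = (case j of 0 \<Rightarrow> 0 | Suc k \<Rightarrow> A i k)"
proof (cases j)
  case 0
  then show ?thesis by (subst mmul_single[of 0]) (auto simp: Shift_def)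
next
  case (Suc k)
  then show ?thesis by (subst mmul_single[of k]) (auto simp: Shift_def)
qed

lemma lower_unitri_imp_band: "lower_unitri A \<Longrightarrow> lower_band 0 A"
  by (simp add: lower_unitri_def lower_band_def)

lemma lower_band_Shift: "lower_band 1 Shift"
  by (simp add: lower_band_def Shift_def)

lemma lower_band_mdiag: "lower_band 0 (mdiag d)"
  by (simp add: lower_band_def mdiag_def)

lemma is_mdiag_imp_band: "is_mdiag A \<Longrightarrow> lower_band 0 A"
  by (auto simp add: lower_band_def is_mdiag_def)

lemma lower_band_strict_lower: "lower_band 0 (strict_lower A)"
  by (simp add: lower_band_def strict_lower_def)

text \<open>Every term of the series vanishes: the factor \<open>A i k\<close> for
  \<open>k < i\<close>, the factor \<open>B k j\<close> for \<open>k \<ge> i > j\<close>.\<close>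

lemma upper_tri_mmul:
  assumes "upper_tri A" and "upper_tri B"
  shows "upper_tri (A \<odot> B)"
  unfolding upper_tri_def
proof (intro allI impI)
  fix i j :: nat assume "j < i"
  then have "A i k * B k j = 0" for k
    using assms unfolding upper_tri_def
    by (metis less_trans linorder_neqE_nat mult_zero_left mult_zero_right)
  then show "(A \<odot> B) i j = 0" by (simp only: mmul_def suminf_zero)
qed

section \<open>Inverses of lower unitriangular matrices\<close>

text \<open>Forward substitution for \<open>A X = mone\<close>, row by row. The diagonal of
  \<open>A\<close> is treated as if it were 1, so the result is lower unitriangular for every
  \<open>A\<close>. The recursion also shows that the entries are polynomials in those of
  \<open>A\<close>, hence differentiable along with them.\<close>

function fwd_subst :: "'a::real_normed_field smat \<Rightarrow> nat \<Rightarrow> nat \<Rightarrow> 'a" where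
  "fwd_subst A i j = (if i = j then 1 else 0) - (\<Sum>k<i. A i k * fwd_subst A k j)"
  by pat_completeness auto
termination by (relation "Wellfounded.measure (\<lambda>(A, i, j). i)") auto

declare fwd_subst.simps [simp del]

lemma lower_unitri_fwd_subst: "lower_unitri (fwd_subst A)"
proof -
  have 0: "fwd_subst A i j = 0" if "i < j" for i j
    using that
  proof (induction i rule: less_induct)
    case (less i)
    then show ?case by (subst fwd_subst.simps) (auto intro!: sum.neutral)
  qed
  have "fwd_subst A i i = 1" for i
    by (subst fwd_subst.simps) (simp add: 0)
  with 0 show ?thesis by (auto simp: lower_unitri_def)
qed

lemma mmul_fwd_subst:
  assumes "lower_unitri A"
  shows "A \<odot> fwd_subst A = mone"
proof (intro ext)
  fix i j
  have "(A \<odot> fwd_subst A) i j = (\<Sum>k<Suc i. A i k * fwd_subst A k j)"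
    by (subst mmul_lower_band[OF lower_unitri_imp_band[OF assms], of i i]) (auto simp: lessThan_Suc_atMost)
  also have "\<dots> = mone i j"
    using assms by (simp add: lower_unitri_def mone_def fwd_subst.simps[of A i])
  finally show "(A \<odot> fwd_subst A) i j = mone i j" .
qed

lemma lower_unitri_inverse_unique:
  assumes "lower_unitri A" and "A \<odot> B = mone" "lower_unitri B" and "C \<odot> A = mone" "lower_unitri C"
  shows "B = C"
  using mmul_assoc[of 0 C 0 A B] assms by (simp add: lower_unitri_imp_band)

lemma minv_eq_fwd_subst:
  assumes A: "lower_unitri A"
  shows "minv A = fwd_subst A" and "minv A \<odot> A = mone"
proof -
  let ?B = "fwd_subst A"
  have B: "lower_unitri ?B" by (rule lower_unitri_fwd_subst)
  \<comment> \<open>\<open>A\<close> is a left inverse of \<open>?B\<close> and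
    \<open>fwd_subst ?B\<close> a right inverse, so they coincide; this turns the right inverse
    \<open>?B\<close> of \<open>A\<close> into a two-sided one.\<close>
  have "fwd_subst ?B = A"
    using lower_unitri_inverse_unique[OF B mmul_fwd_subst[OF B] lower_unitri_fwd_subst mmul_fwd_subst[OF A] A] .
  then have BA: "?B \<odot> A = mone" using mmul_fwd_subst[OF B] by simp
  show eq: "minv A = ?B"
    unfolding minv_def
  proof (rule the_equality)
    show "lower_unitri ?B \<and> A \<odot> ?B = mone \<and> ?B \<odot> A = mone"
      using B BA mmul_fwd_subst[OF A] by simp
    show "C = ?B" if "lower_unitri C \<and> A \<odot> C = mone \<and> C \<odot> A = mone" for C
      using lower_unitri_inverse_unique[OF A _ _ BA B, of C] that by simp
  qed
  show "minv A \<odot> A = mone"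
    using BA by (simp add: eq)
qed

lemma minv_lower_unitri:
  assumes "lower_unitri A"
  shows "A \<odot> minv A = mone" and "minv A \<odot> A = mone" and "lower_unitri (minv A)"
  using minv_eq_fwd_subst[OF assms] mmul_fwd_subst[OF assms] lower_unitri_fwd_subst by simp_all

lemma minv_minv:
  assumes "lower_unitri A"
  shows "minv (minv A) = A"
  using lower_unitri_inverse_unique[of "minv A" "minv (minv A)" A] minv_lower_unitri assms
  by blast

section \<open>The lower triangular Gauss--Borel factor\<close>

text \<open>The two adjugate identities for the leading block of size \<open>n\<close>, in entrywise
  form so that they apply to rows and columns of semi-infinite matrices.\<close>

lemma leading_minor_adj:
  fixes A :: "'a::real_normed_field smat"
  defines "L \<equiv> \<lambda>n. Matrix.mat n n (\<lambda>(i, j). A i j)"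
  assumes "k < n" "m < n"
  shows "(\<Sum>j<n. A k j * adj_mat (L n) $$ (j, m)) = (if k = m then leading_minor A n else 0)"
    and "(\<Sum>j<n. adj_mat (L n) $$ (k, j) * A j m) = (if k = m then leading_minor A n else 0)"
proof -
  have L: "L n \<in> carrier_mat n n" by (simp add: L_def)
  note adj = adj_mat[OF L]
  have minor: "Determinant.det (L n) = leading_minor A n"
    by (simp add: leading_minor_def L_def)
  have "(\<Sum>j<n. A k j * adj_mat (L n) $$ (j, m)) = (L n * adj_mat (L n)) $$ (k, m)"
    using assms(2,3) adj(1) L by (auto simp: scalar_prod_def L_def atLeast0LessThan)
  then show "(\<Sum>j<n. A k j * adj_mat (L n) $$ (j, m)) = (if k = m then leading_minor A n else 0)"
    using assms(2,3) by (simp add: adj(2) minor)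
  have "(\<Sum>j<n. adj_mat (L n) $$ (k, j) * A j m) = (adj_mat (L n) * L n) $$ (k, m)"
    using assms(2,3) adj(1) L by (auto simp: scalar_prod_def L_def atLeast0LessThan)
  then show "(\<Sum>j<n. adj_mat (L n) $$ (k, j) * A j m) = (if k = m then leading_minor A n else 0)"
    using assms(2,3) by (simp add: adj(3) minor)
qed

text \<open>Multiplying the vanishing row vector by the adjugate gives
  \<open>v m * leading_minor A n = 0\<close>.\<close>

lemma leading_left_kernel:
  assumes "leading_minor A n \<noteq> 0" and 0: "\<And>j. j < n \<Longrightarrow> (\<Sum>k<n. v k * A k j) = 0" and "m < n"
  shows "v m = 0"
proof -
  let ?J = "adj_mat (Matrix.mat n n (\<lambda>(i, j). A i j))"
  have "0 = (\<Sum>j<n. (\<Sum>k<n. v k * A k j) * ?J $$ (j, m))"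
    using 0 by simp
  also have "\<dots> = (\<Sum>k<n. v k * (\<Sum>j<n. A k j * ?J $$ (j, m)))"
    by (rule sum_mult_assoc)
  also have "\<dots> = (\<Sum>k<n. v k * (if k = m then leading_minor A n else 0))"
    using \<open>m < n\<close> by (intro sum.cong refl) (simp add: leading_minor_adj)
  also have "\<dots> = v m * leading_minor A n"
    using \<open>m < n\<close> by (simp add: if_distrib[of "(*) _"] sum.delta cong: if_cong)
  finally show ?thesis using assms(1) by simp
qed

text \<open>
  Cramer's rule for the linear system that makes \<open>S A\<close> vanish below the diagonal; the explicit formula
  is what shows that \<open>S\<close> depends differentiably on \<open>\<eta>\<close>.
\<close>

definition gb_left :: "'a::real_normed_field smat \<Rightarrow> 'a smat" where
  "gb_left A = (\<lambda>i j. if i < j then 0 else if i = j then 1 else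
     - (\<Sum>l<i. A i l * adj_mat (Matrix.mat i i (\<lambda>(r, s). A r s)) $$ (l, j)) / leading_minor A i)"

lemma lower_unitri_gb_left: "lower_unitri (gb_left A)"
  by (simp add: lower_unitri_def gb_left_def)

lemma mmul_lower_unitri_row:
  assumes "lower_unitri S"
  shows "(S \<odot> A) i j = (\<Sum>k<i. S i k * A k j) + A i j"
  using assms by (subst mmul_lower_band[OF lower_unitri_imp_band[OF assms], of i i])
    (auto simp: lower_unitri_def simp flip: lessThan_Suc_atMost)

text \<open>Left of the diagonal, row \<open>i\<close> of \<open>gb_left A\<close> is minus row
  \<open>i\<close> of \<open>A\<close> times the inverse of the leading block. Multiplied by that
  block it returns minus row \<open>i\<close> of \<open>A\<close>, which the unit diagonal entry
  cancels.\<close>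

lemma upper_tri_gb_left:
  assumes "\<And>n. leading_minor A n \<noteq> 0"
  shows "upper_tri (gb_left A \<odot> A)"
  unfolding upper_tri_def
proof (intro allI impI)
  fix i m :: nat assume "m < i"
  let ?J = "adj_mat (Matrix.mat i i (\<lambda>(r, s). A r s))"
  have "(\<Sum>k<i. gb_left A i k * A k m)
      = (\<Sum>k<i. (\<Sum>l<i. A i l * ?J $$ (l, k)) * A k m) * (- 1 / leading_minor A i)"
    by (subst sum_distrib_right) (rule sum.cong, auto simp: gb_left_def)
  also have "(\<Sum>k<i. (\<Sum>l<i. A i l * ?J $$ (l, k)) * A k m) = (\<Sum>l<i. A i l * (\<Sum>k<i. ?J $$ (l, k) * A k m))"
    by (rule sum_mult_assoc)
  also have "\<dots> = (\<Sum>l<i. A i l * (if l = m then leading_minor A i else 0))"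
    using \<open>m < i\<close> by (intro sum.cong refl) (simp add: leading_minor_adj)
  also have "\<dots> = A i m * leading_minor A i"
    using \<open>m < i\<close> by (simp add: if_distrib[of "(*) _"] sum.delta cong: if_cong)
  finally show "(gb_left A \<odot> A) i m = 0"
    using assms by (simp add: mmul_lower_unitri_row[OF lower_unitri_gb_left])
qed

text \<open>Otherwise row \<open>i\<close> would lie in the left kernel of the leading block of size
  \<open>Suc i\<close>, although its last coefficient is 1.\<close>

lemma gb_left_diag_nonzero:
  assumes "leading_minor A (Suc i) \<noteq> 0" and "upper_tri (gb_left A \<odot> A)"
  shows "(gb_left A \<odot> A) i i \<noteq> 0"
proof
  assume "(gb_left A \<odot> A) i i = 0"
  with assms(2) have "(gb_left A \<odot> A) i j = 0" if "j < Suc i" for j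
    using that by (cases "j = i") (auto simp: upper_tri_def)
  moreover have "(gb_left A \<odot> A) i j = (\<Sum>k<Suc i. gb_left A i k * A k j)" for j
    using lower_unitri_gb_left[of A]
    by (simp add: mmul_lower_unitri_row[OF lower_unitri_gb_left] lower_unitri_def)
  ultimately have "gb_left A i i = 0"
    using leading_left_kernel[OF assms(1), of "gb_left A i" i] by simp
  then show False by (simp add: gb_left_def)
qed

text \<open>Row \<open>i\<close> of \<open>Z\<close> is supported on the first \<open>i\<close>
  positions and annihilates the first \<open>i\<close> columns of \<open>A\<close>, so it lies in
  the left kernel of a nonsingular leading block. This yields both the uniqueness of
  \<open>S\<close> and the formula for its derivative.\<close>

lemma upper_tri_mmul_imp_zero:
  assumes "\<And>n. leading_minor A n \<noteq> 0" and Z: "\<And>i j. i \<le> j \<Longrightarrow> Z i j = 0" and up: "upper_tri (Z \<odot> A)"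
  shows "Z = 0"
proof (intro ext)
  fix i j
  have "(\<Sum>k<i. Z i k * A k m) = 0" if "m < i" for m
    using up that mmul_finite[of "{..<i}" Z i A m] Z by (auto simp: upper_tri_def)
  from leading_left_kernel[OF assms(1) this] Z show "Z i j = 0 i j"
    by (cases "j < i") auto
qed

lemma lower_unitri_upper_tri_unique:
  assumes "\<And>n. leading_minor A n \<noteq> 0" and S: "lower_unitri S" "upper_tri (S \<odot> A)"
    and R: "lower_unitri R" "upper_tri (R \<odot> A)"
  shows "S = R"
proof -
  have "S - R = 0"
  proof (rule upper_tri_mmul_imp_zero[OF assms(1)])
    show "(S - R) i j = 0" if "i \<le> j" for i j
      using S(1) R(1) that by (cases "i = j") (auto simp: lower_unitri_def)
    show "upper_tri ((S - R) \<odot> A)"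
      using S(2) R(2)
      by (simp add: mmul_diff_left[OF S(1)[THEN lower_unitri_imp_band] R(1)[THEN lower_unitri_imp_band]] upper_tri_def)
  qed
  then show ?thesis by simp
qed

lemma gauss_borel_upper_tri:
  assumes "gauss_borel A S H St"
  shows "upper_tri (S \<odot> A)"
proof -
  let ?V = "mtransp (minv St)"
  have S: "lower_unitri S" "lower_unitri (minv S)" "lower_unitri (minv St)" and H: "is_mdiag H"
    and A: "A = minv S \<odot> H \<odot> ?V"
    using assms by (auto simp: gauss_borel_def minv_lower_unitri)
  note band = S(1,2)[THEN lower_unitri_imp_band] is_mdiag_imp_band[OF H]
  have "S \<odot> A = (S \<odot> minv S) \<odot> (H \<odot> ?V)"
    by (simp add: A mmul_assoc[OF band(2,3)] mmul_assoc[OF band(1,2)])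
  then have "S \<odot> A = H \<odot> ?V" by (simp add: minv_lower_unitri S)
  moreover have "upper_tri H" using H by (auto simp: upper_tri_def is_mdiag_def)
  moreover have "upper_tri ?V" using S(3) by (simp add: upper_tri_def mtransp_def lower_unitri_def)
  ultimately show ?thesis by (simp add: upper_tri_mmul)
qed

lemma gauss_borel_gb_left:
  assumes "\<And>n. leading_minor A n \<noteq> 0"
  shows "\<exists>H St. gauss_borel A (gb_left A) H St"
proof -
  let ?S = "gb_left A"
  let ?P = "?S \<odot> A"
  have up: "upper_tri ?P" and nz: "\<And>i. ?P i i \<noteq> 0"
    using assms by (auto simp: upper_tri_gb_left gb_left_diag_nonzero)
  \<comment> \<open>The diagonal of \<open>S A\<close> is split off as \<open>H\<close>; the
    remaining \<open>V\<close> has unit diagonal, and the inverse of its transpose serves as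
    \<open>St\<close>.\<close>
  define H V where "H = mdiag (\<lambda>i. ?P i i)" and "V = (\<lambda>i j. ?P i j / ?P i i)"
  have V: "lower_unitri (mtransp V)"
    using up nz by (auto simp: lower_unitri_def mtransp_def V_def upper_tri_def)
  have S: "lower_unitri ?S" "lower_unitri (minv ?S)"
    by (simp_all add: lower_unitri_gb_left minv_lower_unitri)
  have HV: "H \<odot> V = ?P"
    using nz by (intro ext) (simp add: H_def V_def mmul_mdiag_left)
  have "minv ?S \<odot> H \<odot> V = minv ?S \<odot> ?P"
    unfolding HV[symmetric]
    by (rule mmul_assoc[OF lower_unitri_imp_band[OF S(2)] lower_band_mdiag[of "\<lambda>i. ?P i i", folded H_def]])
  also have "\<dots> = A"
    by (subst mmul_assoc[symmetric, OF S(2,1)[THEN lower_unitri_imp_band]]) (simp add: minv_lower_unitri S)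
  finally have "gauss_borel A ?S H (minv (mtransp V))"
    using V S by (simp add: gauss_borel_def minv_minv minv_lower_unitri)
      (auto simp: H_def is_mdiag_def mdiag_def mtransp_def)
  then show ?thesis by blast
qed

text \<open>Every Gauss--Borel factor \<open>S\<close> makes \<open>S A\<close> upper triangular,
  and only one unitriangular matrix does so. The definite description thus becomes an explicit
  formula that can be differentiated.\<close>

lemma gauss_borel_S_eq:
  assumes "\<And>n. leading_minor A n \<noteq> 0"
  shows "gauss_borel_S A = gb_left A"
  unfolding gauss_borel_S_def
proof (rule the_equality)
  show "\<exists>H St. gauss_borel A (gb_left A) H St"
    by (rule gauss_borel_gb_left[OF assms])
next
  fix S assume "\<exists>H St. gauss_borel A S H St"
  then obtain H St where gb: "gauss_borel A S H St" by blast
  then show "S = gb_left A"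
    using lower_unitri_upper_tri_unique[OF assms _ gauss_borel_upper_tri[OF gb] lower_unitri_gb_left upper_tri_gb_left[OF assms]]
    by (simp add: gauss_borel_def)
qed

section \<open>The operator \<open>\<vartheta>\<close> on matrix functions\<close>

text \<open>Openness refers to the product topology. A partial derivative moves a single coordinate,
  and changing one coordinate is continuous.\<close>

lemma open_fun_upd_vimage:
  fixes U :: "('i \<Rightarrow> 'a::topological_space) set"
  assumes "open U"
  shows "open {z. \<eta>(a := z) \<in> U}"
proof -
  have "continuous_on UNIV (\<lambda>z. (\<eta>(a := z)) i)" for i
    by (cases "i = a") auto
  then have "continuous_on UNIV (\<lambda>z. \<eta>(a := z))"
    by (rule continuous_on_coordinatewise_then_product)
  then have "open ((\<lambda>z. \<eta>(a := z)) -` U)"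
    by (rule open_vimage[OF assms])
  then show ?thesis by (simp add: vimage_def)
qed

lemma eventually_fun_upd:
  fixes U :: "('i \<Rightarrow> 'a::topological_space) set"
  assumes "open U" and "\<eta> \<in> U"
  shows "eventually (\<lambda>z. \<eta>(a := z) \<in> U) (nhds (\<eta> a))"
  using eventually_nhds_in_open[OF open_fun_upd_vimage[OF assms(1)], of "\<eta> a" \<eta> a] assms(2) by simp

text \<open>A derivative depends on the germ only, so identities known on \<open>U\<close> alone may
  be differentiated at a point of \<open>U\<close>.\<close>

lemma theta_cong:
  assumes "open U" and "\<eta> \<in> U" and "\<And>\<xi>. \<xi> \<in> U \<Longrightarrow> F \<xi> i j = G \<xi> i j"
  shows "theta p F \<eta> i j = theta p G \<eta> i j"
  unfolding theta_def
proof (intro sum.cong refl arg_cong2[where f="(*)"] deriv_cong_ev)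
  show "eventually (\<lambda>z. F (\<eta>(a := z)) i j = G (\<eta>(a := z)) i j) (nhds (\<eta> a))" for a
    using eventually_fun_upd[OF assms(1,2)] by (rule eventually_mono) (rule assms(3))
qed

lemma partials_exist_cong:
  assumes "open U" and "\<eta> \<in> U" and "\<And>\<xi>. \<xi> \<in> U \<Longrightarrow> F \<xi> = G \<xi>" and "partials_exist p F \<eta>"
  shows "partials_exist p G \<eta>"
  unfolding partials_exist_def
proof (intro ballI allI)
  fix a i j assume "a \<in> {1..p}"
  then obtain D where D: "((\<lambda>z. F (\<eta>(a := z)) i j) has_field_derivative D) (at (\<eta> a))"
    using assms(4) unfolding partials_exist_def field_differentiable_def by blast
  have "((\<lambda>z. G (\<eta>(a := z)) i j) has_field_derivative D) (at (\<eta> a))"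
    by (rule has_field_derivative_transform_within_open[OF D open_fun_upd_vimage[OF assms(1), of \<eta> a]])
       (use assms(2,3) in auto)
  then show "(\<lambda>z. G (\<eta>(a := z)) i j) field_differentiable at (\<eta> a)"
    by (auto simp: field_differentiable_def)
qed

lemma theta_const:
  assumes "open U" and "\<eta> \<in> U" and "\<And>\<xi>. \<xi> \<in> U \<Longrightarrow> F \<xi> i j = c"
  shows "theta p F \<eta> i j = 0"
proof -
  have "theta p F \<eta> i j = theta p (\<lambda>_ _ _. c) \<eta> i j"
    by (rule theta_cong[where U=U]) (use assms in auto)
  then show ?thesis by (simp add: theta_def)
qed

lemma partials_exist_mmul:
  assumes A: "\<And>\<xi>. lower_band m (A \<xi>)" and "partials_exist p A \<eta>" and "partials_exist p B \<eta>"
  shows "partials_exist p (\<lambda>\<xi>. A \<xi> \<odot> B \<xi>) \<eta>"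
  using assms(2,3)
  by (simp add: partials_exist_def mmul_lower_band[OF A order_refl]
      field_differentiable_sum field_differentiable_mult)

text \<open>The bound \<open>m\<close> is uniform in the parameter, so each entry is a fixed finite
  sum and no derivative has to be exchanged with a series.\<close>

lemma theta_mmul:
  assumes A: "\<And>\<xi>. lower_band m (A \<xi>)" and "partials_exist p A \<eta>" and "partials_exist p B \<eta>"
  shows "theta p (\<lambda>\<xi>. A \<xi> \<odot> B \<xi>) \<eta> = theta p A \<eta> \<odot> B \<eta> + A \<eta> \<odot> theta p B \<eta>"
proof (intro ext)
  fix i j
  have d: "deriv (\<lambda>z. \<Sum>k\<le>i+m. A (\<eta>(a := z)) i k * B (\<eta>(a := z)) k j) (\<eta> a)
      = (\<Sum>k\<le>i+m. deriv (\<lambda>z. A (\<eta>(a := z)) i k) (\<eta> a) * B \<eta> k j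
                  + A \<eta> i k * deriv (\<lambda>z. B (\<eta>(a := z)) k j) (\<eta> a))"
    if "a \<in> {1..p}" for a
  proof (rule DERIV_imp_deriv, rule DERIV_sum)
    fix k
    have "((\<lambda>z. A (\<eta>(a := z)) i k) has_field_derivative deriv (\<lambda>z. A (\<eta>(a := z)) i k) (\<eta> a)) (at (\<eta> a))"
      and "((\<lambda>z. B (\<eta>(a := z)) k j) has_field_derivative deriv (\<lambda>z. B (\<eta>(a := z)) k j) (\<eta> a)) (at (\<eta> a))"
      using assms(2,3) that by (auto simp: partials_exist_def DERIV_deriv_iff_field_differentiable)
    from DERIV_mult[OF this]
    show "((\<lambda>z. A (\<eta>(a := z)) i k * B (\<eta>(a := z)) k j) has_field_derivative
        deriv (\<lambda>z. A (\<eta>(a := z)) i k) (\<eta> a) * B \<eta> k j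
        + A \<eta> i k * deriv (\<lambda>z. B (\<eta>(a := z)) k j) (\<eta> a)) (at (\<eta> a))"
      by (simp add: ac_simps)
  qed
  have band: "lower_band m (theta p A \<eta>)"
    using A by (simp add: lower_band_def theta_def)
  have "theta p (\<lambda>\<xi>. A \<xi> \<odot> B \<xi>) \<eta> i j
      = (\<Sum>a=1..p. \<eta> a * (\<Sum>k\<le>i+m. deriv (\<lambda>z. A (\<eta>(a := z)) i k) (\<eta> a) * B \<eta> k j
                  + A \<eta> i k * deriv (\<lambda>z. B (\<eta>(a := z)) k j) (\<eta> a)))"
    unfolding theta_def mmul_lower_band[OF A order_refl] by (intro sum.cong refl) (simp add: d)
  also have "\<dots> = (\<Sum>k\<le>i+m. theta p A \<eta> i k * B \<eta> k j) + (\<Sum>k\<le>i+m. A \<eta> i k * theta p B \<eta> k j)"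
    unfolding theta_def sum_distrib_left sum_distrib_right
    by (subst (2 3) sum.swap) (simp add: algebra_simps sum.distrib)
  finally show "theta p (\<lambda>\<xi>. A \<xi> \<odot> B \<xi>) \<eta> i j = (theta p A \<eta> \<odot> B \<eta> + A \<eta> \<odot> theta p B \<eta>) i j"
    by (simp add: mmul_lower_band[OF A order_refl] mmul_lower_band[OF band order_refl])
qed

section \<open>Differentiability of determinants, of the Gauss--Borel factor and of inverses\<close>

lemma field_differentiable_prod:
  fixes f :: "'i \<Rightarrow> 'a::real_normed_field \<Rightarrow> 'a"
  assumes "\<And>i. i \<in> I \<Longrightarrow> f i field_differentiable at x"
  shows "(\<lambda>z. \<Prod>i\<in>I. f i z) field_differentiable at x"
  using assms by (induction I rule: infinite_finite_induct) (auto intro!: field_differentiable_mult)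

lemma field_differentiable_det:
  fixes f :: "'a::real_normed_field \<Rightarrow> nat \<Rightarrow> nat \<Rightarrow> 'a"
  assumes "\<And>i j. i < n \<Longrightarrow> j < n \<Longrightarrow> (\<lambda>z. f z i j) field_differentiable at x"
  shows "(\<lambda>z. Determinant.det (Matrix.mat n n (\<lambda>(i, j). f z i j))) field_differentiable at x"
proof -
  have "(\<lambda>z. \<Sum>q\<in>{q. q permutes {0..<n}}. signof q * (\<Prod>i = 0..<n. f z i (q i))) field_differentiable at x"
    by (intro field_differentiable_sum field_differentiable_mult field_differentiable_const
        field_differentiable_prod assms) (auto dest: permutes_in_image)
  also have "(\<lambda>z. \<Sum>q\<in>{q. q permutes {0..<n}}. signof q * (\<Prod>i = 0..<n. f z i (q i)))
      = (\<lambda>z. Determinant.det (Matrix.mat n n (\<lambda>(i, j). f z i j)))"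
    unfolding Determinant.det_def
    by (auto intro!: ext sum.cong prod.cong dest: permutes_in_image)
  finally show ?thesis .
qed

text \<open>Each entry is a quotient of polynomials in the entries of \<open>M\<close>, with a
  denominator that does not vanish at \<open>\<eta>\<close>.\<close>

lemma partials_exist_gb_left:
  assumes M: "partials_exist p M \<eta>" and nz: "\<And>n. leading_minor (M \<eta>) n \<noteq> 0"
  shows "partials_exist p (\<lambda>\<xi>. gb_left (M \<xi>)) \<eta>"
  unfolding partials_exist_def
proof (intro ballI allI)
  fix a i j assume a: "a \<in> {1..p}"
  define f where "f = (\<lambda>z. M (\<eta>(a := z)))"
  have f: "(\<lambda>z. f z r s) field_differentiable at (\<eta> a)" for r s
    using M a by (simp add: partials_exist_def f_def)
  have minor: "(\<lambda>z. leading_minor (f z) n) field_differentiable at (\<eta> a)" for n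
    unfolding leading_minor_def by (intro field_differentiable_det f)
  have cof: "(\<lambda>z. adj_mat (Matrix.mat n n (\<lambda>(r, s). f z r s)) $$ (l, k)) field_differentiable at (\<eta> a)"
    if "l < n" "k < n" for n l k
  proof -
    \<comment> \<open>\<open>h t\<close> enumerates the indices other than \<open>t\<close>; the
      adjugate entry \<open>(l, k)\<close> is the cofactor that deletes row \<open>k\<close> and
      column \<open>l\<close>.\<close>
    define h where "h = (\<lambda>t. \<lambda>s::nat. if s < t then s else Suc s)"
    have "adj_mat (Matrix.mat n n (\<lambda>(r, s). f z r s)) $$ (l, k)
      = (-1)^(k+l) * Determinant.det (Matrix.mat (n - 1) (n - 1) (\<lambda>(r, s). f z (h k r) (h l s)))" for z
      using that by (auto simp: adj_mat_def cofactor_def mat_delete_def h_def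
          intro!: arg_cong[where f="Determinant.det"] cong_mat)
    then show ?thesis
      by (simp add: field_differentiable_mult field_differentiable_det f)
  qed
  have "(\<lambda>z. gb_left (f z) i j) field_differentiable at (\<eta> a)"
  proof (cases "j < i")
    case True
    then have "(\<lambda>z. gb_left (f z) i j)
      = (\<lambda>z. - (\<Sum>l<i. f z i l * adj_mat (Matrix.mat i i (\<lambda>(r, s). f z r s)) $$ (l, j)) / leading_minor (f z) i)"
      by (auto simp: gb_left_def)
    with True nz show ?thesis
      by (auto intro!: field_differentiable_divide field_differentiable_minus field_differentiable_sum
          field_differentiable_mult f minor cof) (auto simp: f_def)
  next
    case False
    then show ?thesis by (cases "i = j") (simp_all add: gb_left_def)
  qed
  then show "(\<lambda>z. gb_left (M (\<eta>(a := z))) i j) field_differentiable at (\<eta> a)"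
    by (simp add: f_def)
qed

text \<open>Differentiability passes from row to row along the recursion of
  \<open>fwd_subst\<close>.\<close>

lemma partials_exist_minv:
  assumes S: "\<And>\<xi>. lower_unitri (S \<xi>)" and "partials_exist p S \<eta>"
  shows "partials_exist p (\<lambda>\<xi>. minv (S \<xi>)) \<eta>"
  unfolding partials_exist_def minv_eq_fwd_subst(1)[OF S]
proof (intro ballI allI)
  fix a i j assume a: "a \<in> {1..p}"
  show "(\<lambda>z. fwd_subst (S (\<eta>(a := z))) i j) field_differentiable at (\<eta> a)"
  proof (induction i rule: less_induct)
    case (less i)
    show ?case
      unfolding fwd_subst.simps[of _ i]
      using assms(2) a by (intro field_differentiable_diff field_differentiable_const
          field_differentiable_sum field_differentiable_mult less) (auto simp: partials_exist_def)
  qed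
qed

section \<open>The Lax equation\<close>

lemma theta_recurrence_matrix:
  fixes S M :: "(nat \<Rightarrow> 'a::real_normed_field) \<Rightarrow> 'a smat" and \<eta> :: "nat \<Rightarrow> 'a"
  assumes U: "open U" "\<eta> \<in> U" and S: "\<And>\<xi>. lower_unitri (S \<xi>)"
    and dS: "partials_exist p S \<eta>" and dM: "partials_exist p M \<eta>"
    and up: "\<And>\<xi>. \<xi> \<in> U \<Longrightarrow> upper_tri (S \<xi> \<odot> M \<xi>)"
    and nz: "\<And>n. leading_minor (M \<eta>) n \<noteq> 0"
    and thM: "theta p M \<eta> = Shift \<odot> M \<eta>"
  defines "T \<equiv> \<lambda>\<xi>. S \<xi> \<odot> Shift \<odot> minv (S \<xi>)"
  defines "L \<equiv> strict_lower (T \<eta>)"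
  shows "partials_exist p T \<eta>" and "theta p T \<eta> = T \<eta> \<odot> L - L \<odot> T \<eta>"
proof -
  define R where "R = minv (S \<eta>)"
  have R: "lower_unitri R" "S \<eta> \<odot> R = mone"
    using minv_lower_unitri[OF S] by (simp_all add: R_def)
  have bS: "lower_band 0 (S \<xi>)" "lower_band 0 (minv (S \<xi>))" for \<xi>
    using S minv_lower_unitri(3)[OF S] by (auto intro: lower_unitri_imp_band)
  have bSh: "lower_band 1 (S \<xi> \<odot> Shift)" for \<xi>
    using lower_band_mmul[OF bS(1) lower_band_Shift] by simp
  have bT: "lower_band 1 (T \<xi>)" for \<xi>
    using lower_band_mmul[OF bSh bS(2)] by (simp add: T_def)
  have bL: "lower_band 0 L" by (simp add: L_def lower_band_strict_lower)
  have TS: "T \<xi> \<odot> S \<xi> = S \<xi> \<odot> Shift" for \<xi>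
    unfolding T_def mmul_assoc[OF bSh bS(2)] by (simp add: minv_lower_unitri[OF S])
  have dSh: "partials_exist p (\<lambda>_. Shift) \<eta>"
    by (simp add: partials_exist_def)
  show dT: "partials_exist p T \<eta>"
    unfolding T_def
    by (rule partials_exist_mmul[OF bSh partials_exist_mmul[OF bS(1) dS dSh] partials_exist_minv[OF S dS]])
  let ?D = "theta p S \<eta>"
  \<comment> \<open>On and above the diagonal the entries of \<open>S\<close> are the constants 1
    and 0.\<close>
  have D0: "?D i j = 0" if "i \<le> j" for i j
    using S that by (intro theta_const[OF U, where c="if i = j then 1 else 0"]) (auto simp: lower_unitri_def)
  then have bD: "lower_band 0 ?D"
    by (simp add: lower_band_def)
  have bLS: "lower_band 0 (L \<odot> S \<eta>)"
    using lower_band_mmul[OF bL bS(1)] by simp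

  have "?D + L \<odot> S \<eta> = 0"
  proof (rule upper_tri_mmul_imp_zero[OF nz])
    show "(?D + L \<odot> S \<eta>) i j = 0" if "i \<le> j" for i j
    proof -
      have "(L \<odot> S \<eta>) i j = 0"
        using that S[of \<eta>] by (subst mmul_lower_band[OF bL order_refl])
          (auto simp: L_def strict_lower_def lower_unitri_def intro!: sum.neutral)
      with D0[OF that] show ?thesis by simp
    qed
    let ?P = "S \<eta> \<odot> M \<eta>"
    have "theta p (\<lambda>\<xi>. S \<xi> \<odot> M \<xi>) \<eta> = ?D \<odot> M \<eta> + S \<eta> \<odot> (Shift \<odot> M \<eta>)"
      by (simp add: theta_mmul[OF bS(1) dS dM] thM)
    \<comment> \<open>The relation \<open>T S = S \<Lambda>\<close> turns
      \<open>S \<Lambda> M\<close> into \<open>T (S M)\<close>.\<close>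
    also have "S \<eta> \<odot> (Shift \<odot> M \<eta>) = T \<eta> \<odot> ?P"
      unfolding mmul_assoc[OF bS(1) lower_band_Shift, symmetric] TS[symmetric]
      by (rule mmul_assoc[OF bT bS(1)])
    finally have "?D \<odot> M \<eta> = theta p (\<lambda>\<xi>. S \<xi> \<odot> M \<xi>) \<eta> - T \<eta> \<odot> ?P"
      by (simp only: add_diff_cancel_right')
    moreover have "(?D + L \<odot> S \<eta>) \<odot> M \<eta> = ?D \<odot> M \<eta> + L \<odot> ?P"
      by (simp add: mmul_add_left[OF bD bLS] mmul_assoc[OF bL bS(1)])
    ultimately have "(?D + L \<odot> S \<eta>) \<odot> M \<eta> = theta p (\<lambda>\<xi>. S \<xi> \<odot> M \<xi>) \<eta> - (T \<eta> - L) \<odot> ?P"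
      by (simp add: mmul_diff_left[OF bT bL])
    \<comment> \<open>The entries of \<open>S M\<close> below the diagonal vanish throughout
      \<open>U\<close>, not just at \<open>\<eta>\<close>, so their derivatives vanish too.\<close>
    moreover have "upper_tri (theta p (\<lambda>\<xi>. S \<xi> \<odot> M \<xi>) \<eta>)"
      unfolding upper_tri_def using up by (auto intro!: theta_const[OF U] simp: upper_tri_def)
    moreover have "upper_tri ((T \<eta> - L) \<odot> ?P)"
      by (rule upper_tri_mmul[OF _ up[OF U(2)]]) (simp add: upper_tri_def L_def strict_lower_def)
    ultimately show "upper_tri ((?D + L \<odot> S \<eta>) \<odot> M \<eta>)"
      by (simp add: upper_tri_def)
  qed
  then have D: "?D = - (L \<odot> S \<eta>)" by (simp add: eq_neg_iff_add_eq_0)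

  \<comment> \<open>The Leibniz rule on both sides of \<open>T S = S \<Lambda>\<close>, where
    \<open>Shift\<close> is constant.\<close>
  have "theta p T \<eta> \<odot> S \<eta> + T \<eta> \<odot> ?D = ?D \<odot> Shift"
  proof -
    have "theta p (\<lambda>_. Shift) \<eta> = 0"
      by (intro ext) (simp add: theta_def)
    moreover have "S \<eta> \<odot> 0 = 0"
      by (intro ext) (simp add: mmul_def)
    ultimately show ?thesis
      using theta_mmul[OF bT dT dS] theta_mmul[OF bS(1) dS dSh] by (simp add: TS)
  qed
  then have "theta p T \<eta> \<odot> S \<eta> = T \<eta> \<odot> (L \<odot> S \<eta>) - (L \<odot> S \<eta>) \<odot> Shift"
    by (simp add: D mmul_minus_right[OF bT] mmul_minus_left[OF bLS] algebra_simps)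
  also have "\<dots> = (T \<eta> \<odot> L) \<odot> S \<eta> - (L \<odot> T \<eta>) \<odot> S \<eta>"
    by (simp only: mmul_assoc[OF bT bL] mmul_assoc[OF bL bT] mmul_assoc[OF bL bS(1)] TS)
  also have "\<dots> = (T \<eta> \<odot> L - L \<odot> T \<eta>) \<odot> S \<eta>"
    by (rule mmul_diff_left[OF lower_band_mmul[OF bT bL] lower_band_mmul[OF bL bT], symmetric])
  finally have eq: "theta p T \<eta> \<odot> S \<eta> = (T \<eta> \<odot> L - L \<odot> T \<eta>) \<odot> S \<eta>" .
  \<comment> \<open>Both sides are banded, so right multiplication by the inverse \<open>R\<close>
    can be reassociated and cancels \<open>S\<close>.\<close>
  have "lower_band 1 (theta p T \<eta>)"
    using bT by (simp add: lower_band_def theta_def)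
  moreover have "lower_band 1 (T \<eta> \<odot> L - L \<odot> T \<eta>)"
    using lower_band_mmul[OF bT bL] lower_band_mmul[OF bL bT] by (simp add: lower_band_def)
  ultimately show "theta p T \<eta> = T \<eta> \<odot> L - L \<odot> T \<eta>"
    using arg_cong[OF eq, of "\<lambda>X. X \<odot> R"] by (simp add: mmul_assoc[OF _ bS(1)] R)
qed

section \<open>Derivatives of the moments\<close>

text \<open>Termwise differentiation of a power series requires convergence at a point of strictly
  larger norm; openness of the domain supplies one.\<close>

lemma open_contains_larger_norm:
  fixes x :: "'a::real_normed_field"
  assumes "open V" and "x \<in> V"
  obtains y where "y \<in> V" and "norm x < norm y"
proof -
  obtain e where e: "e > 0" "cball x e \<subseteq> V"
    using assms by (meson open_contains_cball)
  \<comment> \<open>The unit vector points radially outward; since \<open>sgn 0 = 0\<close>, the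
    origin gets its own choice.\<close>
  define u where "u = (if x = 0 then 1 else sgn x)"
  have "norm u = 1" by (simp add: u_def norm_sgn)
  then have "x + e *\<^sub>R u \<in> V"
    using e by (auto simp: dist_norm intro!: subsetD[OF e(2)])
  moreover have "norm x < norm (x + e *\<^sub>R u)"
  proof (cases "x = 0")
    case True
    then show ?thesis using e by (simp add: u_def)
  next
    case False
    then have "x + e *\<^sub>R u = (1 + e / norm x) *\<^sub>R x"
      by (simp add: u_def sgn_div_norm scaleR_add_left divide_inverse)
    also have "norm \<dots> = norm x + e"
      using False e by (simp add: distrib_right abs_of_pos add_pos_pos)
    finally show ?thesis using e by simp
  qed
  ultimately show thesis by (rule that)
qed

text \<open>In the single variable \<open>\<eta> a\<close> the moment is a power series.
  Differentiating termwise and multiplying by \<open>\<eta> a\<close> brings down a factor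
  \<open>k\<close>, which raises the order of the moment by one.\<close>

lemma moment_has_field_derivative:
  fixes \<eta> :: "nat \<Rightarrow> 'a::{real_normed_field, banach}"
  assumes U: "open U" "\<eta> \<in> U"
    and summ: "\<And>\<xi>. \<xi> \<in> U \<Longrightarrow> summable (\<lambda>k. norm (of_nat k ^ m * weight Mb N b c \<xi> a k))"
  obtains D where "((\<lambda>z. moment Mb N b c (\<eta>(a := z)) a m) has_field_derivative D) (at (\<eta> a))"
    and "\<eta> a * D = moment Mb N b c \<eta> a (Suc m)"
proof -
  define C where "C = (\<lambda>k. (\<Prod>i=1..Mb a. pochhammer (b a i) k) / (\<Prod>j=1..N. pochhammer (c j) k) / fact k)"
  define d where "d = (\<lambda>k. of_nat k ^ m * C k)"
  have w: "of_nat k ^ m * weight Mb N b c (\<eta>(a := z)) a k = d k * z ^ k" for k z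
    by (simp add: weight_def C_def d_def)
  obtain K where "\<eta>(a := K) \<in> U" and K: "norm (\<eta> a) < norm K"
    using open_contains_larger_norm[OF open_fun_upd_vimage[OF U(1), of \<eta> a], of "\<eta> a"] U(2) by auto
  from summable_norm_cancel[OF summ[OF this(1)]] have sK: "summable (\<lambda>k. d k * K ^ k)"
    by (simp only: w)
  let ?D = "\<Sum>k. diffs d k * \<eta> a ^ k"
  have "summable (\<lambda>k. diffs d k * \<eta> a ^ k)"
    by (rule termdiff_converges[OF K]) (rule powser_inside[OF sK])
  from sums_mult[OF diffs_equiv[OF this], of "\<eta> a"]
  have "(\<lambda>k. \<eta> a * (of_nat k * d k * \<eta> a ^ (k - Suc 0))) sums (\<eta> a * ?D)" .
  \<comment> \<open>At \<open>k = 0\<close> the truncated exponent does no harm because of the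
    factor \<open>of_nat k\<close>.\<close>
  also have "(\<lambda>k. \<eta> a * (of_nat k * d k * \<eta> a ^ (k - Suc 0)))
      = (\<lambda>k. of_nat k ^ Suc m * weight Mb N b c \<eta> a k)"
  proof
    fix k
    have "\<eta> a * (of_nat k * d k * \<eta> a ^ (k - Suc 0)) = of_nat k * (d k * \<eta> a ^ k)"
      by (cases k) simp_all
    also have "\<dots> = of_nat k ^ Suc m * weight Mb N b c \<eta> a k"
      using w[of k "\<eta> a"] by (simp add: mult.assoc)
    finally show "\<eta> a * (of_nat k * d k * \<eta> a ^ (k - Suc 0)) = of_nat k ^ Suc m * weight Mb N b c \<eta> a k" .
  qed
  finally have "\<eta> a * ?D = moment Mb N b c \<eta> a (Suc m)"
    unfolding moment_def by (rule sums_unique)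
  moreover have "((\<lambda>z. moment Mb N b c (\<eta>(a := z)) a m) has_field_derivative ?D) (at (\<eta> a))"
    unfolding moment_def w by (rule termdiffs_strong[OF sK K])
  ultimately show thesis using that by blast
qed

lemma moment_fun_upd_other:
  "a \<noteq> a' \<Longrightarrow> moment Mb N b c (\<eta>(a := z)) a' m = moment Mb N b c \<eta> a' m"
  by (simp add: moment_def weight_def)

text \<open>Column \<open>j\<close> depends on the variable with index \<open>j mod p + 1\<close>
  alone, so one summand of \<open>theta\<close> survives. It raises the moment order, which amounts
  to passing to the next row.\<close>

lemma theta_moment_matrix:
  fixes \<eta> :: "nat \<Rightarrow> 'a::{real_normed_field, banach}"
  assumes "p \<ge> 1" and U: "open U" "\<eta> \<in> U"
    and summ: "\<And>\<xi> a m. \<xi> \<in> U \<Longrightarrow> a \<in> {1..p} \<Longrightarrow>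
           summable (\<lambda>k. norm (of_nat k ^ m * weight Mb N b c \<xi> a k))"
  shows "partials_exist p (moment_matrix p Mb N b c) \<eta>"
    and "theta p (moment_matrix p Mb N b c) \<eta> = Shift \<odot> moment_matrix p Mb N b c \<eta>"
proof -
  let ?M = "moment_matrix p Mb N b c"
  have *: "(\<lambda>z. ?M (\<eta>(a := z)) i j) field_differentiable at (\<eta> a) \<and>
      \<eta> a * deriv (\<lambda>z. ?M (\<eta>(a := z)) i j) (\<eta> a) = (if a = j mod p + 1 then ?M \<eta> (Suc i) j else 0)"
    if ap: "a \<in> {1..p}" for a i j
  proof (cases "a = j mod p + 1")
    case True
    obtain D where D: "((\<lambda>z. moment Mb N b c (\<eta>(a := z)) a (i + j div p)) has_field_derivative D) (at (\<eta> a))"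
      and eq: "\<eta> a * D = moment Mb N b c \<eta> a (Suc (i + j div p))"
      by (rule moment_has_field_derivative[OF U summ[OF _ ap]])
    show ?thesis
      using D DERIV_imp_deriv[OF D] eq
      by (auto simp: moment_matrix_def True field_differentiable_def)
  next
    case False
    then show ?thesis by (simp add: moment_matrix_def moment_fun_upd_other)
  qed
  show "partials_exist p ?M \<eta>"
    unfolding partials_exist_def using * by blast
  show "theta p ?M \<eta> = Shift \<odot> ?M \<eta>"
  proof (intro ext)
    fix i j
    have "j mod p + 1 \<in> {1..p}" using assms(1) by (simp add: Suc_leI)
    moreover have "theta p ?M \<eta> i j = (\<Sum>a=1..p. if a = j mod p + 1 then ?M \<eta> (Suc i) j else 0)"
      unfolding theta_def using * by (intro sum.cong refl) blast
    ultimately show "theta p ?M \<eta> i j = (Shift \<odot> ?M \<eta>) i j"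
      by (simp add: mmul_Shift_left)
  qed
qed

section \<open>Entries of the recurrence matrix\<close>

lemma recurrence_matrix_hessenberg:
  assumes S: "lower_unitri S"
  defines "T \<equiv> S \<odot> Shift \<odot> minv S"
  shows "lower_band 1 T" and "T i (Suc i) = 1"
proof -
  have R: "lower_unitri (minv S)" by (rule minv_lower_unitri(3)[OF S])
  have "lower_band 1 (S \<odot> Shift)"
    using lower_band_mmul[OF lower_unitri_imp_band[OF S] lower_band_Shift] by simp
  from lower_band_mmul[OF this lower_unitri_imp_band[OF R]]
  show "lower_band 1 T" by (simp add: T_def)
  \<comment> \<open>For \<open>k < Suc i\<close> the inverse factor vanishes, being above its
    diagonal; for \<open>k > Suc i\<close> the entry of \<open>S \<Lambda>\<close> does.\<close>
  have "T i (Suc i) = (S \<odot> Shift) i (Suc i) * minv S (Suc i) (Suc i)"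
    unfolding T_def
  proof (rule mmul_single)
    fix k assume "k \<noteq> Suc i"
    then show "(S \<odot> Shift) i k * minv S k (Suc i) = 0"
      using S R by (cases "k < Suc i") (auto simp: mmul_Shift_right lower_unitri_def split: nat.split)
  qed
  also have "\<dots> = 1"
    using S R by (simp add: mmul_Shift_right lower_unitri_def)
  finally show "T i (Suc i) = 1" .
qed

text \<open>Going down one row of \<open>M\<close> equals going right by \<open>p\<close> columns,
  so \<open>T (S M) = S \<Lambda> M\<close> is \<open>S M\<close> shifted by \<open>p\<close>
  columns. As \<open>S M\<close> is upper triangular with nonzero diagonal, the vanishing of the
  entries of \<open>T\<close> follows column by column.\<close>

lemma recurrence_matrix_banded:
  assumes S: "lower_unitri S" and up: "upper_tri (S \<odot> M)" and nz: "\<And>i. (S \<odot> M) i i \<noteq> 0"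
    and M: "\<And>i j. M (Suc i) j = M i (j + p)"
    and "j + p < i"
  shows "(S \<odot> Shift \<odot> minv S) i j = 0"
  using assms(5)
proof (induction j rule: less_induct)
  case (less j)
  let ?T = "S \<odot> Shift \<odot> minv S"
  let ?P = "S \<odot> M"
  note bS = lower_unitri_imp_band[OF S]
  note bR = lower_unitri_imp_band[OF minv_lower_unitri(3)[OF S]]
  note bT = recurrence_matrix_hessenberg(1)[OF S]
  have bSS: "lower_band 1 (S \<odot> Shift)"
    using lower_band_mmul[OF bS lower_band_Shift] by simp
  have "?T \<odot> ?P = (?T \<odot> S) \<odot> M"
    by (rule mmul_assoc[OF bT bS, symmetric])
  also have "?T \<odot> S = S \<odot> Shift"
    unfolding mmul_assoc[OF bSS bR] by (simp add: minv_lower_unitri[OF S])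
  also have "(S \<odot> Shift) \<odot> M = S \<odot> (Shift \<odot> M)"
    by (rule mmul_assoc[OF bS lower_band_Shift])
  finally have "(?T \<odot> ?P) i j = ?P i (j + p)"
    by (simp add: mmul_def[of S] mmul_Shift_left M)
  also have "\<dots> = 0" using up less.prems by (simp add: upper_tri_def)
  also have "(?T \<odot> ?P) i j = ?T i j * ?P j j"
  proof (rule mmul_single)
    fix k assume "k \<noteq> j"
    then consider "k < j" | "j < k" by linarith
    then show "?T i k * ?P k j = 0"
    proof cases
      case 1
      then show ?thesis using less.IH less.prems by simp
    next
      case 2
      then show ?thesis using up by (simp add: upper_tri_def)
    qed
  qed
  finally show ?case using nz[of j] by simp
qed

text \<open>With \<open>T = D + L + \<Lambda>\<close> and \<open>D\<close> diagonal, the term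
  \<open>L L\<close> cancels in the commutator. The value 0 at \<open>j = 0\<close> is the empty
  first column of \<open>L \<Lambda>\<close>.\<close>

lemma commutator_strict_lower:
  assumes T: "lower_band 1 T" "\<And>i. T i (Suc i) = 1"
  defines "L \<equiv> strict_lower T"
  shows "(T \<odot> L - L \<odot> T) i j
    = L (Suc i) j - (case j of 0 \<Rightarrow> 0 | Suc k \<Rightarrow> L i k) + (T i i - T j j) * L i j"
proof -
  define D where "D = mdiag (\<lambda>k. T k k)"
  have bL: "lower_band 0 L" by (simp add: L_def lower_band_strict_lower)
  have bD: "lower_band 0 D" by (simp add: D_def lower_band_mdiag)
  have bDL: "lower_band 0 (D + L)" using bL bD by (simp add: lower_band_def)
  have dec: "T = D + L + Shift"
  proof (intro ext)
    fix i j
    consider "j < i" | "j = i" | "j = Suc i" | "Suc i < j" by linarith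
    then show "T i j = (D + L + Shift) i j"
      using T by cases (auto simp: D_def L_def strict_lower_def mdiag_def Shift_def lower_band_def)
  qed
  have "T \<odot> L = D \<odot> L + L \<odot> L + Shift \<odot> L"
    by (subst dec) (simp add: mmul_add_left[OF bDL lower_band_Shift] mmul_add_left[OF bD bL])
  moreover have "L \<odot> T = L \<odot> D + L \<odot> L + L \<odot> Shift"
    by (subst dec) (simp add: mmul_add_right[OF bL])
  ultimately have "(T \<odot> L - L \<odot> T) i j
      = (D \<odot> L) i j + (Shift \<odot> L) i j - ((L \<odot> D) i j + (L \<odot> Shift) i j)"
    by simp
  then show ?thesis
    by (simp add: D_def mmul_mdiag_left mmul_mdiag_right mmul_Shift_left mmul_Shift_right algebra_simps)
qed

section \<open>Diagonals of the recurrence matrix and of the Lax equation\<close>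

lemma mpow_mtransp_Shift: "mpow (mtransp Shift) m i j = (if i = j + m then 1 else 0)"
proof (induction m arbitrary: i)
  case 0
  then show ?case by (simp add: mone_def)
next
  case (Suc m)
  have Sh: "mtransp Shift r s = (if r = Suc s then 1 else 0)" for r s
    by (simp add: mtransp_def Shift_def)
  \<comment> \<open>Row 0 of the transposed shift is zero, so the truncated index
    \<open>i - 1\<close> is harmless there.\<close>
  show ?case
    by (cases i; subst mpow.simps, subst mmul_single[of "i - 1"]) (auto simp: Sh Suc.IH)
qed

lemma smat_sum_apply: "(\<Sum>m\<in>F. A m) i j = (\<Sum>m\<in>F. A m i j)" for A :: "'b \<Rightarrow> 'a::comm_monoid_add smat"
  by (induction F rule: infinite_finite_induct) auto

lemma banded_decomposition:
  assumes T: "lower_band 1 T" "\<And>i. T i (Suc i) = 1" "\<And>i j. j + p < i \<Longrightarrow> T i j = 0"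
  shows "T = Shift + (\<Sum>m=0..p. mpow (mtransp Shift) m \<odot> subdiag m T)"
proof (intro ext)
  fix i j
  have "(\<Sum>m=0..p. mpow (mtransp Shift) m \<odot> subdiag m T) i j
      = (\<Sum>m=0..p. if i = j + m then T (j + m) j else 0)"
    by (auto simp: smat_sum_apply subdiag_def mmul_mdiag_right mpow_mtransp_Shift intro!: sum.cong)
  also have "\<dots> = (if j \<le> i then T i j else 0)"
  proof (cases "j \<le> i \<and> i - j \<le> p")
    case True
    then have "(\<Sum>m=0..p. if i = j + m then T (j + m) j else 0) = (\<Sum>m=0..p. if m = i - j then T i j else 0)"
      by (intro sum.cong) auto
    with True show ?thesis by simp
  next
    case False
    then have "(\<Sum>m=0..p. if i = j + m then T (j + m) j else 0) = 0"
      by (intro sum.neutral) auto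
    with False T(3)[of j i] show ?thesis by auto
  qed
  finally show "T i j = (Shift + (\<Sum>m=0..p. mpow (mtransp Shift) m \<odot> subdiag m T)) i j"
    using T(1,2) by (cases "j = Suc i") (auto simp: Shift_def lower_band_def)
qed

lemma shift_minus_funpow: "(shift_minus ^^ n) (mdiag d) = mdiag (\<lambda>k. d (k + n))"
proof (induction n)
  case (Suc n)
  have "shift_minus (mdiag (\<lambda>k. d (k + n))) = mdiag (\<lambda>k. d (k + Suc n))"
    by (simp add: shift_minus_def) (simp add: mdiag_def)
  with Suc show ?case by simp
qed simp

lemma partials_exist_subdiag:
  "partials_exist p T \<eta> \<Longrightarrow> partials_exist p (\<lambda>\<xi>. subdiag m (T \<xi>)) \<eta>"
  unfolding partials_exist_def subdiag_def mdiag_def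
  by (intro ballI allI, rename_tac a i j, case_tac "i = j") auto

lemma theta_subdiag: "theta p (\<lambda>\<xi>. subdiag m (T \<xi>)) \<eta> = subdiag m (theta p T \<eta>)"
  by (intro ext) (simp add: theta_def subdiag_def mdiag_def)

text \<open>At position \<open>(k + n, k)\<close> the two products with the shift give the
  difference of diagonals of order \<open>n + 1\<close>, and the diagonal part of \<open>T\<close>
  gives the last product. At \<open>n = 0\<close> that product vanishes, in accordance with
  \<open>L\<close> being strictly lower triangular.\<close>

lemma subdiag_commutator:
  assumes T: "lower_band 1 T" "\<And>i. T i (Suc i) = 1"
  shows "subdiag n (T \<odot> strict_lower T - strict_lower T \<odot> T)
    = subdiag (n + 1) T - shift_plus (subdiag (n + 1) T)
      + subdiag n T \<odot> ((shift_minus ^^ n) (subdiag 0 T) - subdiag 0 T)"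
proof (intro ext)
  fix i j
  have "(subdiag n T \<odot> ((shift_minus ^^ n) (subdiag 0 T) - subdiag 0 T)) i j
      = (if i = j then T (j + n) j * (T (j + n) (j + n) - T j j) else 0)"
    by (simp add: subdiag_def shift_minus_funpow mmul_mdiag_left) (simp add: mdiag_def)
  then show "subdiag n (T \<odot> strict_lower T - strict_lower T \<odot> T) i j
    = (subdiag (n + 1) T - shift_plus (subdiag (n + 1) T)
      + subdiag n T \<odot> ((shift_minus ^^ n) (subdiag 0 T) - subdiag 0 T)) i j"
    unfolding subdiag_def[of n "T \<odot> strict_lower T - strict_lower T \<odot> T"]
      commutator_strict_lower[OF T]
    by (auto simp: subdiag_def mdiag_def shift_plus_def strict_lower_def split: nat.split)
qed

theorem proposition3p11:
  fixes p N :: nat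
    and Mb :: "nat \<Rightarrow> nat"
    and b :: "nat \<Rightarrow> nat \<Rightarrow> 'a::{real_normed_field, banach}"
    and c :: "nat \<Rightarrow> 'a"
    and U :: "(nat \<Rightarrow> 'a) set"
    and T :: "(nat \<Rightarrow> 'a) \<Rightarrow> 'a smat"
    and \<alpha> :: "nat \<Rightarrow> (nat \<Rightarrow> 'a) \<Rightarrow> 'a smat"
    and \<eta> :: "nat \<Rightarrow> 'a"
  assumes "p \<ge> 1"
    and "\<And>j. j \<in> {1..N} \<Longrightarrow> c j \<notin> \<int>\<^sub>\<le>\<^sub>0"
    and "open U"
    and "\<And>\<xi> a m. \<xi> \<in> U \<Longrightarrow> a \<in> {1..p} \<Longrightarrow>
           summable (\<lambda>k. norm (of_nat k ^ m * weight Mb N b c \<xi> a k))"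
    and "\<And>\<xi> n. \<xi> \<in> U \<Longrightarrow> leading_minor (moment_matrix p Mb N b c \<xi>) n \<noteq> 0"
    and "\<And>\<xi>. T \<xi> = recurrence_matrix (moment_matrix p Mb N b c \<xi>)"
    and "\<And>m \<xi>. \<alpha> m \<xi> = subdiag m (T \<xi>)"
    and "\<eta> \<in> U"
  shows "(T \<eta> = Shift + (\<Sum>m=0..p. mpow (mtransp Shift) m \<odot> \<alpha> m \<eta>)) \<and>
         (\<forall>m\<in>{0..p}. partials_exist p (\<alpha> m) \<eta>) \<and>
         (theta p (\<alpha> 0) \<eta> = \<alpha> 1 \<eta> - shift_plus (\<alpha> 1 \<eta>)) \<and>
         (\<forall>n\<in>{0..p-1}. theta p (\<alpha> n) \<eta> =
           \<alpha> (n+1) \<eta> - shift_plus (\<alpha> (n+1) \<eta>)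
             + \<alpha> n \<eta> \<odot> ((shift_minus ^^ n) (\<alpha> 0 \<eta>) - \<alpha> 0 \<eta>)) \<and>
         (theta p (\<alpha> p) \<eta> = \<alpha> p \<eta> \<odot> ((shift_minus ^^ p) (\<alpha> 0 \<eta>) - \<alpha> 0 \<eta>))"
proof -
  define M where "M = moment_matrix p Mb N b c"
  \<comment> \<open>Given by the explicit formula, \<open>S\<close> is unitriangular for every
    parameter, also outside \<open>U\<close>, so the band bounds are uniform. The description behind
    \<open>T\<close> is resolved on \<open>U\<close>, where \<open>T'\<close> agrees with
    it.\<close>
  define S where "S = (\<lambda>\<xi>. gb_left (M \<xi>))"
  define T' where "T' = (\<lambda>\<xi>. S \<xi> \<odot> Shift \<odot> minv (S \<xi>))"
  note U = assms(3,8)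
  have nz: "leading_minor (M \<xi>) n \<noteq> 0" if "\<xi> \<in> U" for \<xi> n
    using assms(5)[OF that] by (simp add: M_def)
  have S: "lower_unitri (S \<xi>)" for \<xi>
    by (simp add: S_def lower_unitri_gb_left)
  have up: "upper_tri (S \<xi> \<odot> M \<xi>)" if "\<xi> \<in> U" for \<xi>
    unfolding S_def by (rule upper_tri_gb_left[OF nz[OF that]])
  have TT': "T' \<xi> = T \<xi>" if "\<xi> \<in> U" for \<xi>
    by (simp add: assms(6) recurrence_matrix_def T'_def S_def gauss_borel_S_eq[OF nz[OF that]] flip: M_def)
  note dM = theta_moment_matrix[OF assms(1) U assms(4), folded M_def]
  have dS: "partials_exist p S \<eta>"
    unfolding S_def by (rule partials_exist_gb_left[OF dM(1) nz[OF U(2)]])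
  note lax = theta_recurrence_matrix[OF U S dS dM(1) up nz[OF U(2)] dM(2), folded T'_def]
  have dT: "partials_exist p T \<eta>"
    by (rule partials_exist_cong[OF U TT' lax(1)])
  have "theta p T \<eta> = theta p T' \<eta>"
    by (intro ext theta_cong[OF U]) (simp add: TT')
  then have thT: "theta p T \<eta> = T \<eta> \<odot> strict_lower (T \<eta>) - strict_lower (T \<eta>) \<odot> T \<eta>"
    using lax(2) by (simp add: TT'[OF U(2), symmetric] T'_def)
  have hess: "lower_band 1 (T \<eta>)" "T \<eta> i (Suc i) = 1" for i
    using recurrence_matrix_hessenberg[OF S[of \<eta>]] TT'[OF U(2)] by (simp_all add: T'_def)
  \<comment> \<open>Adding \<open>p\<close> to the column index keeps the residue, hence the weight,
    and raises the quotient by one.\<close>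
  have "M \<eta> (Suc i) j = M \<eta> i (j + p)" for i j
    using assms(1) by (simp add: M_def moment_matrix_def)
  then have band: "T \<eta> i j = 0" if "j + p < i" for i j
    using recurrence_matrix_banded[OF S up[OF U(2)] _ _ that] gb_left_diag_nonzero[OF nz[OF U(2)] up[OF U(2), unfolded S_def]]
      TT'[OF U(2)] by (simp add: T'_def S_def)
  have \<alpha>: "\<alpha> m = (\<lambda>\<xi>. subdiag m (T \<xi>))" for m
    using assms(7) by auto
  have toda: "theta p (\<alpha> n) \<eta> = \<alpha> (n+1) \<eta> - shift_plus (\<alpha> (n+1) \<eta>)
             + \<alpha> n \<eta> \<odot> ((shift_minus ^^ n) (\<alpha> 0 \<eta>) - \<alpha> 0 \<eta>)" for n
    unfolding \<alpha> theta_subdiag thT by (rule subdiag_commutator[OF hess])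
  \<comment> \<open>The diagonal of order \<open>p + 1\<close> lies outside the band, so
    \<open>toda\<close> at \<open>n = p\<close> becomes the last equation.\<close>
  have "\<alpha> (p+1) \<eta> = 0" "shift_plus (\<alpha> (p+1) \<eta>) = 0"
    by (auto simp: \<alpha> subdiag_def mdiag_def shift_plus_def band fun_eq_iff split: nat.split)
  then have "theta p (\<alpha> p) \<eta> = \<alpha> p \<eta> \<odot> ((shift_minus ^^ p) (\<alpha> 0 \<eta>) - \<alpha> 0 \<eta>)"
    using toda[of p] by simp
  moreover have "theta p (\<alpha> 0) \<eta> = \<alpha> 1 \<eta> - shift_plus (\<alpha> 1 \<eta>)"
  proof -
    \<comment> \<open>At \<open>n = 0\<close> the bracket is the difference of
      \<open>\<alpha> 0 \<eta>\<close> with itself.\<close>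
    have "\<alpha> 0 \<eta> \<odot> 0 = 0" by (intro ext) (simp add: mmul_def)
    then show ?thesis using toda[of 0] by simp
  qed
  moreover have "T \<eta> = Shift + (\<Sum>m=0..p. mpow (mtransp Shift) m \<odot> \<alpha> m \<eta>)"
    unfolding \<alpha> by (rule banded_decomposition[OF hess band])
  moreover have "partials_exist p (\<alpha> m) \<eta>" for m
    unfolding \<alpha> by (rule partials_exist_subdiag[OF dT])
  ultimately show ?thesis using toda by blast
qed

end
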